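(* For each choice of sign and each $\lambda\in\mathbb C^\times$, the substitution $$\rho_\pm(\lambda):\quad \mathcal E_1=\lambda\alpha_\pm,\qquad \mathcal E_0=\lambda\alpha_\mp,\qquad \mathcal K_1=q^{\pm\mathcal H},\qquad \mathcal K_0=q^{\mp\mathcal H}$$ provides an infinite-dimensional representation (on Fock modules of the $q$-oscillator algebra) of the upper Borel subalgebra $\mathfrak b_+$ of $U_q(C^{(2)}(2))$.
   Context: $q=e^{\pi i b^2}\in\mathbb C^\times$ with $q^2\ne-1$, and $q^x=e^{\pi ib^2x}$. The $q$-oscillator algebra is generated by odd elements $\alpha_+,\alpha_-$ and an even element $\mathcal H$ with $q\alpha_+\alpha_-+q^{-1}\alpha_-\alpha_+=-\frac{1}{q+q^{-1}}$ and $[\mathcal H,\alpha_\pm]=\pm2\alpha_\pm$. Its Fock modules are $\Pi_\pm=\mathrm{span}\{\alpha_\pm^k|0\rangle_\pm\}_{k\ge0}$ (the vectors $\alpha_\pm^k|0\rangle_\pm$ being a basis), where $|0\rangle_\pm$ is even, $\mathcal H|0\rangle_\pm=0$ and $\alpha_\mp|0\rangle_\pm=0$; $q^{\pm\mathcal H}$ acts diagonally. The upper Borel subalgebra $\mathfrak b_+$ of $U_q(C^{(2)}(2))$ is the superalgebra with odd generators $\mathcal E_0,\mathcal E_1$ and even invertible commuting generators $\mathcal K_0,\mathcal K_1$, with relations $\mathcal K_i\mathcal E_j=q^{a_{ij}}\mathcal E_j\mathcal K_i$, where $(a_{ij})=\begin{pmatrix}2&-2\\-2&2\end{pmatrix}$,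 and the Serre relations $\mathcal E_i^3\mathcal E_j+\{3\}_q\mathcal E_i^2\mathcal E_j\mathcal E_i-\{3\}_q\mathcal E_i\mathcal E_j\mathcal E_i^2-\mathcal E_j\mathcal E_i^3=0$ for $i\ne j$, $\{3\}_q=\frac{q^3+q^{-3}}{q+q^{-1}}$. *)

theory Defs
  imports
    Complex_Main
    "HOL-Library.Poly_Mapping"
    "HOL-Computational_Algebra.Polynomial"
    "HOL-Algebra.Module"
    "HOL-Algebra.QuotRing"
begin

section \<open>Superalgebras given by generators and relations\<close>

text \<open>A complex associative superalgebra is a ring record with a scalar multiplication and its
  homogeneous parts. Parities are booleans, \<^const>\<open>True\<close> being odd; the sum of two parities is
  \<open>\<noteq>\<close>.\<close>

record 'a superalgebra = "(complex, 'a) module" +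
  hpart :: "bool \<Rightarrow> 'a set"

definition superalg_hom ::
  "('a, 'x) superalgebra_scheme \<Rightarrow> ('b, 'y) superalgebra_scheme \<Rightarrow> ('a \<Rightarrow> 'b) set" where
  "superalg_hom A B = {f \<in> ring_hom A B.
     (\<forall>c. \<forall>x\<in>carrier A. f (c \<odot>\<^bsub>A\<^esub> x) = c \<odot>\<^bsub>B\<^esub> f x) \<and>
     (\<forall>p. f ` hpart A p \<subseteq> hpart B p)}"

text \<open>Words form a monoid under concatenation, so that \<open>'g list \<Rightarrow>\<^sub>0 complex\<close> with its convolution
  product is the free associative algebra on \<open>'g\<close>.\<close>

instantiation list :: (type) monoid_add
begin

definition zero_list :: "'a list" where "zero_list = []"
definition plus_list :: "'a list \<Rightarrow> 'a list \<Rightarrow> 'a list" where "plus_list u v = u @ v"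

instance by standard (simp_all add: zero_list_def plus_list_def)

end

type_synonym 'g free_alg = "'g list \<Rightarrow>\<^sub>0 complex"

definition gen :: "'g \<Rightarrow> 'g free_alg" where
  "gen g = Poly_Mapping.single [g] 1"

definition scal :: "complex \<Rightarrow> 'g free_alg" where
  "scal c = Poly_Mapping.single [] c"

definition word_parity :: "('g \<Rightarrow> bool) \<Rightarrow> 'g list \<Rightarrow> bool" where
  "word_parity par w = odd (length (filter par w))"

definition free_superalgebra :: "('g \<Rightarrow> bool) \<Rightarrow> 'g free_alg superalgebra" where
  "free_superalgebra par =
     \<lparr>carrier = UNIV, monoid.mult = (*), one = 1, zero = 0, add = (+),
      smult = (\<lambda>c x. scal c * x),
      hpart = (\<lambda>p. {x. \<forall>w\<in>Poly_Mapping.keys x. word_parity par w = p})\<rparr>"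

definition quot_superalgebra ::
  "('a, 'x) superalgebra_scheme \<Rightarrow> 'a set \<Rightarrow> 'a set superalgebra" where
  "quot_superalgebra A I =
     \<lparr>carrier = carrier (A Quot I), monoid.mult = monoid.mult (A Quot I), one = one (A Quot I),
      zero = zero (A Quot I), add = add (A Quot I),
      smult = (\<lambda>c X. \<Union>x\<in>X. I +>\<^bsub>A\<^esub> (c \<odot>\<^bsub>A\<^esub> x)),
      hpart = (\<lambda>p. (\<lambda>x. I +>\<^bsub>A\<^esub> x) ` hpart A p)\<rparr>"

text \<open>The relations are elements of the free algebra that are set to zero.\<close>

definition presented :: "('g \<Rightarrow> bool) \<Rightarrow> 'g free_alg set \<Rightarrow> 'g free_alg set superalgebra" where
  "presented par R =
     quot_superalgebra (free_superalgebra par) (genideal (free_superalgebra par) R)"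

definition presented_gen :: "('g \<Rightarrow> bool) \<Rightarrow> 'g free_alg set \<Rightarrow> 'g \<Rightarrow> 'g free_alg set" where
  "presented_gen par R g =
     genideal (free_superalgebra par) R +>\<^bsub>free_superalgebra par\<^esub> gen g"


section \<open>Representations on superspaces\<close>

definition superspace :: "(complex \<Rightarrow> 'v \<Rightarrow> 'v::ab_group_add) \<Rightarrow> (bool \<Rightarrow> 'v set) \<Rightarrow> bool" where
  "superspace scale V \<longleftrightarrow> vector_space scale \<and>
     (\<forall>p. module.subspace scale (V p)) \<and>
     V False \<inter> V True = {0} \<and>
     (\<forall>v. \<exists>x\<in>V False. \<exists>y\<in>V True. v = x + y)"

definition End_super ::
  "(complex \<Rightarrow> 'v \<Rightarrow> 'v::ab_group_add) \<Rightarrow> (bool \<Rightarrow> 'v set) \<Rightarrow> ('v \<Rightarrow> 'v) superalgebra" where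
  "End_super scale V =
     \<lparr>carrier = {f. Vector_Spaces.linear scale scale f},
      monoid.mult = (\<circ>), one = id, zero = (\<lambda>v. 0), add = (\<lambda>f g v. f v + g v),
      smult = (\<lambda>c f v. scale c (f v)),
      hpart = (\<lambda>p. {f. Vector_Spaces.linear scale scale f \<and> (\<forall>r. f ` V r \<subseteq> V (r \<noteq> p))})\<rparr>"

definition superrep ::
  "('a, 'x) superalgebra_scheme \<Rightarrow> (complex \<Rightarrow> 'v \<Rightarrow> 'v::ab_group_add) \<Rightarrow> (bool \<Rightarrow> 'v set)
     \<Rightarrow> ('a \<Rightarrow> 'v \<Rightarrow> 'v) \<Rightarrow> bool" where
  "superrep A scale V \<rho> \<longleftrightarrow> superspace scale V \<and> \<rho> \<in> superalg_hom A (End_super scale V)"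

definition infinite_dimensional :: "(complex \<Rightarrow> 'v \<Rightarrow> 'v::ab_group_add) \<Rightarrow> bool" where
  "infinite_dimensional scale \<longleftrightarrow> \<not> (\<exists>B. finite B \<and> module.span scale B = UNIV)"


section \<open>The q-oscillator algebra and its Fock modules\<close>

text \<open>\<open>qpow b x\<close> is \<open>q\<^sup>x\<close> for \<open>q = exp (\<pi> i b\<^sup>2)\<close>; the choice of \<open>b\<close> fixes the branch.\<close>

definition qpow :: "complex \<Rightarrow> complex \<Rightarrow> complex" where
  "qpow b x = exp (of_real pi * \<i> * b\<^sup>2 * x)"

datatype sign = Pos | Neg

fun opp :: "sign \<Rightarrow> sign" where
  "opp Pos = Neg"
| "opp Neg = Pos"

fun sgn_val :: "sign \<Rightarrow> complex" where
  "sgn_val Pos = 1"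
| "sgn_val Neg = - 1"

datatype osc_gens = Alpha sign | Ham

definition osc_parity :: "osc_gens \<Rightarrow> bool" where
  "osc_parity g \<longleftrightarrow> g \<noteq> Ham"

definition osc_rels :: "complex \<Rightarrow> osc_gens free_alg set" where
  "osc_rels b =
     {scal (qpow b 1) * gen (Alpha Pos) * gen (Alpha Neg)
        + scal (qpow b (- 1)) * gen (Alpha Neg) * gen (Alpha Pos)
        + scal (1 / (qpow b 1 + qpow b (- 1)))}
     \<union> {gen Ham * gen (Alpha s) - gen (Alpha s) * gen Ham
          - scal (2 * sgn_val s) * gen (Alpha s) | s. True}"

definition osc :: "complex \<Rightarrow> osc_gens free_alg set superalgebra" where
  "osc b = presented osc_parity (osc_rels b)"

definition osc_gen :: "complex \<Rightarrow> osc_gens \<Rightarrow> osc_gens free_alg set" where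
  "osc_gen b = presented_gen osc_parity (osc_rels b)"

definition fock_module ::
  "complex \<Rightarrow> sign \<Rightarrow> (complex \<Rightarrow> 'v \<Rightarrow> 'v::ab_group_add) \<Rightarrow> (bool \<Rightarrow> 'v set)
     \<Rightarrow> (osc_gens free_alg set \<Rightarrow> 'v \<Rightarrow> 'v) \<Rightarrow> 'v \<Rightarrow> bool" where
  "fock_module b t scale V \<pi> vac \<longleftrightarrow>
     superrep (osc b) scale V \<pi> \<and>
     vac \<in> V False \<and>
     \<pi> (osc_gen b Ham) vac = 0 \<and>
     \<pi> (osc_gen b (Alpha (opp t))) vac = 0 \<and>
     (let e = (\<lambda>k. (\<pi> (osc_gen b (Alpha t)) ^^ k) vac) in
        inj e \<and> \<not> module.dependent scale (range e) \<and> module.span scale (range e) = UNIV)"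

text \<open>\<open>T\<close> is the operator \<open>q\<^bsup>zH\<^esup>\<close>, for a diagonalizable operator \<open>H\<close>: it multiplies the
  eigenvectors of \<open>H\<close> with eigenvalue \<open>\<mu>\<close> by \<open>q\<^bsup>z\<mu>\<^esup>\<close>. As these eigenvectors span the
  space, \<open>T\<close> is unique.\<close>

definition is_qpow_op ::
  "complex \<Rightarrow> complex \<Rightarrow> (complex \<Rightarrow> 'v \<Rightarrow> 'v::ab_group_add) \<Rightarrow> ('v \<Rightarrow> 'v) \<Rightarrow> ('v \<Rightarrow> 'v) \<Rightarrow> bool" where
  "is_qpow_op b z scale H T \<longleftrightarrow>
     module.span scale {v. \<exists>\<mu>. H v = scale \<mu> v} = UNIV \<and>
     Vector_Spaces.linear scale scale T \<and>
     (\<forall>\<mu> v. H v = scale \<mu> v \<longrightarrow> T v = scale (qpow b (z * \<mu>)) v)"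


section \<open>The upper Borel subalgebra\<close>

datatype node = N0 | N1

definition cartan :: "node \<Rightarrow> node \<Rightarrow> int" where
  "cartan i j = (if i = j then 2 else - 2)"

datatype borel_gens = E node | K node | Kinv node

fun borel_parity :: "borel_gens \<Rightarrow> bool" where
  "borel_parity (E i) = True"
| "borel_parity (K i) = False"
| "borel_parity (Kinv i) = False"

definition brace3 :: "complex \<Rightarrow> complex" where
  "brace3 b = (qpow b 3 + qpow b (- 3)) / (qpow b 1 + qpow b (- 1))"

definition borel_rels :: "complex \<Rightarrow> borel_gens free_alg set" where
  "borel_rels b =
     {gen (K i) * gen (Kinv i) - 1 | i. True} \<union>
     {gen (Kinv i) * gen (K i) - 1 | i. True} \<union>
     {gen (K i) * gen (K j) - gen (K j) * gen (K i) | i j. True} \<union>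
     {gen (K i) * gen (E j) - scal (qpow b (of_int (cartan i j))) * gen (E j) * gen (K i)
        | i j. True} \<union>
     {gen (E i) ^ 3 * gen (E j)
        + scal (brace3 b) * gen (E i) ^ 2 * gen (E j) * gen (E i)
        - scal (brace3 b) * gen (E i) * gen (E j) * gen (E i) ^ 2
        - gen (E j) * gen (E i) ^ 3 | i j. i \<noteq> j}"

definition borel :: "complex \<Rightarrow> borel_gens free_alg set superalgebra" where
  "borel b = presented borel_parity (borel_rels b)"

definition borel_gen :: "complex \<Rightarrow> borel_gens \<Rightarrow> borel_gens free_alg set" where
  "borel_gen b = presented_gen borel_parity (borel_rels b)"

end

theory Submission
  imports Defs
begin

text \<open>A presented superalgebra acts on a superspace as soon as homogeneous operators for the
  generators satisfy the relations, so only the defining relations have to be checked. On a Fock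
  module \<open>\<alpha>\<^sub>\<plusminus>\<close> shifts the eigenvalue of \<open>H\<close> by \<open>\<plusminus>2\<close>, which gives the relations with the \<open>K\<^sub>i\<close>. The
  q-commutation relation has the form \<open>y x = a x y + d\<close> with \<open>a = -q\<^sup>2\<close> or \<open>a = -q\<^sup>-\<^sup>2\<close>, and the Serre
  relation follows from it because \<open>1 + a + a\<^sup>2 + {3}\<^sub>q a = 0\<close>.\<close>


section \<open>Representations of presented superalgebras\<close>

lemma free_superalgebra_simps [simp]:
  "carrier (free_superalgebra par) = UNIV"
  "x \<otimes>\<^bsub>free_superalgebra par\<^esub> y = x * y"
  "\<one>\<^bsub>free_superalgebra par\<^esub> = 1"
  "\<zero>\<^bsub>free_superalgebra par\<^esub> = 0"
  "x \<oplus>\<^bsub>free_superalgebra par\<^esub> y = x + y"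
  "c \<odot>\<^bsub>free_superalgebra par\<^esub> x = scal c * x"
  by (simp_all add: free_superalgebra_def)

lemma ring_free_superalgebra: "ring (free_superalgebra par)"
proof (intro ringI abelian_groupI monoidI; simp add: algebra_simps)
  fix x :: "'a free_alg"
  show "\<exists>y. x + y = 0" by (rule exI[of _ "- x"]) simp
qed

lemma End_super_simps [simp]:
  "carrier (End_super scale V) = {f. Vector_Spaces.linear scale scale f}"
  "f \<otimes>\<^bsub>End_super scale V\<^esub> g = f \<circ> g"
  "\<one>\<^bsub>End_super scale V\<^esub> = id"
  "f \<oplus>\<^bsub>End_super scale V\<^esub> g = (\<lambda>v. f v + g v)"
  "c \<odot>\<^bsub>End_super scale V\<^esub> f = (\<lambda>v. scale c (f v))"
  "hpart (End_super scale V) p =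
     {f. Vector_Spaces.linear scale scale f \<and> (\<forall>r. f ` V r \<subseteq> V (r \<noteq> p))}"
  by (simp_all add: End_super_def)

text \<open>Unlike in \<open>update_induct\<close>, the new monomial may be arbitrary, so an
  identity between additive maps on the free algebra reduces to monomials without side
  conditions.\<close>

lemma poly_mapping_single_add_induct [case_names zero add]:
  assumes "P 0" and "\<And>k c f. P f \<Longrightarrow> P (Poly_Mapping.single k c + f)"
  shows "P (f :: 'a \<Rightarrow>\<^sub>0 'b::comm_monoid_add)"
proof (induction f rule: Poly_Mapping.update_induct)
  case (update f k c)
  have "Poly_Mapping.update k c f = Poly_Mapping.single k c + f"
    using update(1)
    by (intro poly_mapping_eqI)
       (auto simp: lookup_add lookup_single lookup_update when_def in_keys_iff)
  then show ?case using assms(2) update by simp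
qed (use assms(1) in simp)

lemma scal_mult_single: "scal c * Poly_Mapping.single w d = Poly_Mapping.single w (c * d)"
  unfolding scal_def mult_single by (simp add: plus_list_def)

lemma single_Cons:
  "Poly_Mapping.single (g # w) c = scal c * (gen g * Poly_Mapping.single w 1)"
  unfolding gen_def mult_single scal_mult_single by (simp add: plus_list_def)

lemma single_Nil_one: "Poly_Mapping.single [] 1 = (1 :: 'g free_alg)"
  using single_one[where 'a="'g list" and 'b=complex] by (simp add: zero_list_def)

lemma word_parity_Nil [simp]: "word_parity par [] = False"
  and word_parity_Cons [simp]: "word_parity par (g # w) = (par g \<noteq> word_parity par w)"
  by (auto simp: word_parity_def)

section \<open>Evaluation of the free superalgebra on homogeneous operators\<close>

locale operator_family =
  fixes scale :: "complex \<Rightarrow> 'v \<Rightarrow> 'v::ab_group_add"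
    and V :: "bool \<Rightarrow> 'v set"
    and par :: "'g \<Rightarrow> bool"
    and \<phi> :: "'g \<Rightarrow> 'v \<Rightarrow> 'v"
  assumes superspace: "superspace scale V"
    and lin: "\<And>g. Vector_Spaces.linear scale scale (\<phi> g)"
    and parity: "\<And>g r. \<phi> g ` V r \<subseteq> V (r \<noteq> par g)"
begin

sublocale vector_space scale
  using superspace by (simp add: superspace_def)

text \<open>The homomorphism given by the universal property of the free algebra. The last letter of
  a word acts first, so concatenation of words becomes composition of operators.\<close>

definition free_eval :: "'g free_alg \<Rightarrow> 'v \<Rightarrow> 'v" where
  "free_eval x v = (\<Sum>w\<in>Poly_Mapping.keys x. scale (Poly_Mapping.lookup x w) (foldr \<phi> w v))"

text \<open>Words outside the support contribute zero, so elements with different supports can be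
  summed over one common finite set.\<close>

lemma free_eval_superset:
  assumes "finite S" "Poly_Mapping.keys x \<subseteq> S"
  shows "free_eval x v = (\<Sum>w\<in>S. scale (Poly_Mapping.lookup x w) (foldr \<phi> w v))"
  unfolding free_eval_def
  by (rule sum.mono_neutral_left) (use assms in \<open>auto simp: in_keys_iff\<close>)

lemma free_eval_single: "free_eval (Poly_Mapping.single w c) v = scale c (foldr \<phi> w v)"
  by (subst free_eval_superset[where S="{w}"]) auto

lemma free_eval_zero [simp]: "free_eval 0 v = 0"
  by (simp add: free_eval_def)

lemma free_eval_add [simp]: "free_eval (x + y) v = free_eval x v + free_eval y v"
proof -
  let ?S = "Poly_Mapping.keys x \<union> Poly_Mapping.keys y"
  have "Poly_Mapping.keys (x + y) \<subseteq> ?S" by (rule keys_add)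
  then show ?thesis
    by (simp add: free_eval_superset[of ?S] lookup_add scale_left_distrib sum.distrib)
qed

lemma free_eval_diff [simp]: "free_eval (x - y) v = free_eval x v - free_eval y v"
  using free_eval_add[of "x - y" y v] by simp

lemma linear_foldr: "Vector_Spaces.linear scale scale (foldr \<phi> w)"
proof (induction w)
  case Nil
  then show ?case using linear_id by (simp add: id_def)
next
  case (Cons g w)
  then show ?case using Vector_Spaces.linear_compose[OF Cons lin[of g]] by (simp add: comp_def)
qed

lemma linear_free_eval: "Vector_Spaces.linear scale scale (free_eval x)"
proof -
  interpret w: Vector_Spaces.linear scale scale "foldr \<phi> w" for w by (rule linear_foldr)
  show ?thesis
    unfolding Vector_Spaces.linear_iff free_eval_def
    by (simp add: vector_space_axioms w.add w.scale scale_right_distrib sum.distrib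
        scale_sum_right mult.commute)
qed

text \<open>Both sides are additive in each factor. Two nested inductions, first on \<open>x\<close>
  and then on \<open>y\<close>, reduce the claim to a product of two monomials.\<close>

lemma free_eval_mult [simp]: "free_eval (x * y) v = free_eval x (free_eval y v)"
proof (induction x rule: poly_mapping_single_add_induct)
  case (add u c x)
  interpret w: Vector_Spaces.linear scale scale "foldr \<phi> u" by (rule linear_foldr)
  have "free_eval (Poly_Mapping.single u c * y) v = scale c (foldr \<phi> u (free_eval y v))"
  proof (induction y rule: poly_mapping_single_add_induct)
    case (add k d y)
    then show ?case
      by (simp add: distrib_left mult_single free_eval_single plus_list_def w.add w.scale
          scale_right_distrib)
  qed (simp add: w.zero)
  with add show ?case by (simp add: distrib_right free_eval_single)
qed simp

lemma free_eval_gen [simp]: "free_eval (gen g) v = \<phi> g v"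
  by (simp add: gen_def free_eval_single)

lemma free_eval_scal [simp]: "free_eval (scal c) v = scale c v"
  by (simp add: scal_def free_eval_single)

lemma free_eval_one [simp]: "free_eval 1 v = v"
  using free_eval_single[of "[]" 1 v] by (simp add: single_Nil_one)

lemma free_eval_parity:
  assumes "\<forall>w\<in>Poly_Mapping.keys x. word_parity par w = p" "v \<in> V r"
  shows "free_eval x v \<in> V (r \<noteq> p)"
proof -
  have word: "foldr \<phi> w v \<in> V (r \<noteq> word_parity par w)" for w
  proof (induction w)
    case (Cons g w)
    have "(r \<noteq> word_parity par (g # w)) = ((r \<noteq> word_parity par w) \<noteq> par g)" by auto
    with parity[of g "r \<noteq> word_parity par w"] Cons show ?case by auto
  qed (use assms in simp)
  have sub: "subspace (V (r \<noteq> p))" using superspace by (simp add: superspace_def)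
  show ?thesis
    unfolding free_eval_def
  proof (intro subspace_sum[OF sub] subspace_scale[OF sub])
    fix w assume "w \<in> Poly_Mapping.keys x"
    then have p: "word_parity par w = p" using assms(1) by blast
    show "foldr \<phi> w v \<in> V (r \<noteq> p)" by (rule word[of w, unfolded p])
  qed
qed

text \<open>Freeness: such a map is determined by its values on generators and scalars. It later
  identifies a given representation, pulled back to the free algebra, with
  \<open>free_eval\<close>.\<close>

lemma free_eval_unique:
  assumes add: "\<And>x y v. f (x + y) v = f x v + f y v"
    and mult: "\<And>x y v. f (x * y) v = f x (f y v)"
    and gen: "\<And>g. f (gen g) = \<phi> g"
    and scal: "\<And>c v. f (scal c) v = scale c v"
  shows "f x = free_eval x"
proof
  fix v
  have zero: "f 0 v = 0" for v using add[of 0 0 v] by simp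
  have one: "f (Poly_Mapping.single [] c) v = scale c v" for c v
    using scal by (simp add: scal_def)
  have single: "f (Poly_Mapping.single w c) v = scale c (foldr \<phi> w v)" for w c v
  proof (induction w arbitrary: c)
    case (Cons g w)
    then show ?case by (simp add: single_Cons mult gen scal)
  qed (simp add: one)
  show "f x v = free_eval x v"
    by (induction x rule: poly_mapping_single_add_induct)
       (simp_all add: zero add single free_eval_single)
qed

text \<open>The generated ideal is the least one containing the relations; since the kernel is an
  ideal, it contains all of \<open>genideal\<close> once it contains the relations.\<close>

lemma ideal_free_eval_kernel: "ideal {x. free_eval x = (\<lambda>v. 0)} (free_superalgebra par)"
proof (rule idealI[OF ring_free_superalgebra])
  interpret e: Vector_Spaces.linear scale scale "free_eval x" for x by (rule linear_free_eval)
  interpret F: ring "free_superalgebra par" by (rule ring_free_superalgebra)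
  have inv: "\<ominus>\<^bsub>free_superalgebra par\<^esub> x = - x" for x
    using F.minus_equality[of "- x" x] by simp
  have neg: "free_eval (- x) v = - free_eval x v" for x v
    using free_eval_diff[of 0 x v] by simp
  show "subgroup {x. free_eval x = (\<lambda>v. 0)} (add_monoid (free_superalgebra par))"
  proof (rule F.add.subgroupI)
    show "{x. free_eval x = (\<lambda>v. 0)} \<noteq> {}" using free_eval_zero by blast
  qed (simp_all add: fun_eq_iff inv neg)
  show "x \<otimes>\<^bsub>free_superalgebra par\<^esub> a \<in> {x. free_eval x = (\<lambda>v. 0)}"
    "a \<otimes>\<^bsub>free_superalgebra par\<^esub> x \<in> {x. free_eval x = (\<lambda>v. 0)}"
    if "a \<in> {x. free_eval x = (\<lambda>v. 0)}" for a x
    using that by (auto simp: fun_eq_iff e.zero)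
qed

end

section \<open>Computing with classes modulo the relations\<close>

locale presentation =
  fixes par :: "'g \<Rightarrow> bool" and R :: "'g free_alg set"
begin

abbreviation "F \<equiv> free_superalgebra par"
abbreviation "I \<equiv> genideal F R"
abbreviation "cls x \<equiv> I +>\<^bsub>F\<^esub> x"

sublocale ideal I F
  using ring.genideal_ideal[OF ring_free_superalgebra] by simp

lemma relation_in_ideal: "r \<in> R \<Longrightarrow> r \<in> I"
  using ring.genideal_self[OF ring_free_superalgebra, of R] by auto

lemma cls_iff: "y \<in> cls x \<longleftrightarrow> (\<exists>i\<in>I. y = i + x)"
  by (simp add: a_r_coset_def')

lemma cls_relation: "r \<in> R \<Longrightarrow> cls r = cls 0"
  using a_rcos_const[OF relation_in_ideal] a_rcos_const[of 0]
    additive_subgroup.zero_closed[OF additive_subgroup_axioms] by simp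

lemma presented_carrier: "carrier (presented par R) = range cls"
  unfolding presented_def quot_superalgebra_def FactRing_simps by auto

lemma presented_ops:
  "cls x \<otimes>\<^bsub>presented par R\<^esub> cls y = cls (x * y)"
  "cls x \<oplus>\<^bsub>presented par R\<^esub> cls y = cls (x + y)"
  "\<one>\<^bsub>presented par R\<^esub> = cls 1"
  using rcoset_mult_add[of x y] a_rcos_sum[of x y]
  by (simp_all add: presented_def quot_superalgebra_def FactRing_simps)

text \<open>Scalar multiplication in the quotient is a union over representatives. The ideal absorbs
  \<open>scal c\<close>, so all the united cosets coincide.\<close>

lemma presented_smult: "c \<odot>\<^bsub>presented par R\<^esub> cls x = cls (scal c * x)"
proof -
  have "cls (scal c * y) = cls (scal c * x)" if "y \<in> cls x" for y
  proof -
    obtain i where i: "i \<in> I" "y = i + x" using \<open>y \<in> cls x\<close> by (auto simp: cls_iff)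
    have "scal c * i \<in> I" using I_l_closed[of i "scal c"] i by simp
    then have "scal c * y \<in> cls (scal c * x)" using i by (auto simp: cls_iff distrib_left)
    then show ?thesis by (intro a_repr_independence[OF _ _ a_subgroup, symmetric]) simp_all
  qed
  then have "(\<Union>y\<in>cls x. cls (scal c * y)) = (\<Union>y\<in>cls x. cls (scal c * x))"
    by (rule SUP_cong[OF refl])
  \<comment> \<open>Without a representative, the union of the constant family would be
    empty.\<close>
  moreover have "cls x \<noteq> {}" using a_rcos_self[of x] by auto
  ultimately show ?thesis
    by (simp add: presented_def quot_superalgebra_def)
qed

lemma presented_hpart:
  "hpart (presented par R) p = cls ` {x. \<forall>w\<in>Poly_Mapping.keys x. word_parity par w = p}"
  by (simp add: presented_def quot_superalgebra_def free_superalgebra_def)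

lemma presented_gen_eq: "presented_gen par R g = cls (gen g)"
  by (simp add: presented_gen_def)

lemma gen_hpart: "cls (gen g) \<in> hpart (presented par R) (par g)"
  unfolding presented_hpart by (rule imageI) (simp add: gen_def)

end

text \<open>The universal property of the presentation: evaluation kills the relations, hence the
  ideal they generate, and so factors through the quotient.\<close>

lemma (in operator_family) presented_lift:
  assumes "\<And>r v. r \<in> R \<Longrightarrow> free_eval r v = 0"
  shows "\<exists>\<rho>. superrep (presented par R) scale V \<rho> \<and> (\<forall>g. \<rho> (presented_gen par R g) = \<phi> g)"
proof -
  interpret presentation par R .
  have ker: "free_eval i = (\<lambda>v. 0)" if "i \<in> I" for i
    using ring.genideal_minimal[OF ring_free_superalgebra ideal_free_eval_kernel, of R] that assms
    by auto
  \<comment> \<open>An arbitrary representative is evaluated. The choice does not matter, because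
    two representatives differ by an element of the ideal, which evaluates to zero.\<close>
  define \<rho> where "\<rho> X = free_eval (SOME x. x \<in> X)" for X
  have \<rho>_cls: "\<rho> (cls x) = free_eval x" for x
  proof -
    have "(SOME y. y \<in> cls x) \<in> cls x" by (rule someI[of _ x]) (simp add: a_rcos_self)
    then obtain i where "i \<in> I" "(SOME y. y \<in> cls x) = i + x" by (auto simp: cls_iff)
    then show ?thesis using ker by (simp add: \<rho>_def fun_eq_iff)
  qed
  have "\<rho> \<in> ring_hom (presented par R) (End_super scale V)"
    by (rule ring_hom_memI)
       (auto simp: presented_carrier presented_ops \<rho>_cls linear_free_eval fun_eq_iff)
  moreover have "\<rho> ` hpart (presented par R) p \<subseteq> hpart (End_super scale V) p" for p
    using free_eval_parity by (auto simp: presented_hpart \<rho>_cls linear_free_eval)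
  ultimately have "superrep (presented par R) scale V \<rho>"
    using superspace
    by (auto simp: superrep_def superalg_hom_def presented_carrier presented_smult \<rho>_cls fun_eq_iff)
  then show ?thesis by (auto simp: presented_gen_eq \<rho>_cls fun_eq_iff)
qed

text \<open>The converse direction: it turns an abstract representation into operators for the
  generators that satisfy the relations.\<close>

lemma
  assumes "superrep (presented par R) scale V \<rho>"
  shows presented_operator_family:
      "operator_family scale V par (\<lambda>g. \<rho> (presented_gen par R g))"
    and presented_relation:
      "r \<in> R \<Longrightarrow> operator_family.free_eval scale (\<lambda>g. \<rho> (presented_gen par R g)) r = (\<lambda>v. 0)"
proof -
  interpret presentation par R .
  have hom: "\<rho> \<in> ring_hom (presented par R) (End_super scale V)"
    and sm: "\<And>c x. \<rho> (cls (scal c * x)) = (\<lambda>v. scale c (\<rho> (cls x) v))"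
    and hp: "\<And>p. \<rho> ` hpart (presented par R) p \<subseteq> hpart (End_super scale V) p"
    using assms presented_smult
    by (auto simp: superrep_def superalg_hom_def presented_carrier)
  have add: "\<rho> (cls (x + y)) v = \<rho> (cls x) v + \<rho> (cls y) v" for x y v
    using ring_hom_add[OF hom, of "cls x" "cls y"] by (simp add: presented_carrier presented_ops)
  have mult: "\<rho> (cls (x * y)) v = \<rho> (cls x) (\<rho> (cls y) v)" for x y v
    using ring_hom_mult[OF hom, of "cls x" "cls y"] by (simp add: presented_carrier presented_ops)
  have one: "\<rho> (cls 1) v = v" for v
    using ring_hom_one[OF hom] by (simp add: presented_ops)
  have "\<rho> (cls (gen g)) \<in> hpart (End_super scale V) (par g)" for g
    using hp gen_hpart by blast
  then show "operator_family scale V par (\<lambda>g. \<rho> (presented_gen par R g))"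
    using assms by (intro operator_family.intro) (auto simp: superrep_def presented_gen_eq)
  then interpret operator_family scale V par "\<lambda>g. \<rho> (presented_gen par R g)" .
  \<comment> \<open>Freeness applies to the pullback along \<open>cls\<close>; \<open>scal c\<close>
    acts by \<open>c\<close> because it is \<open>c\<close> times the unit.\<close>
  have ev: "\<rho> (cls x) = free_eval x" for x
    using add mult sm[of _ 1] one
    by (intro free_eval_unique[of "\<lambda>x. \<rho> (cls x)"]) (auto simp: presented_gen_eq)
  show "free_eval r = (\<lambda>v. 0)" if "r \<in> R"
    using cls_relation[OF that] ev[of r] ev[of 0] by (simp add: fun_eq_iff)
qed


section \<open>Operators on Fock modules\<close>

lemma qpow_add: "qpow b (x + y) = qpow b x * qpow b y"
  by (simp add: qpow_def distrib_left exp_add)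

lemma qpow_zero [simp]: "qpow b 0 = 1"
  by (simp add: qpow_def)

lemma qpow_nonzero [simp]: "qpow b x \<noteq> 0"
  by (simp add: qpow_def)

lemma qpow_minus: "qpow b (- x) = inverse (qpow b x)"
  by (simp add: qpow_def exp_minus)

lemma qpow_3: "qpow b 3 = qpow b 1 ^ 3"
  using qpow_add[of b 1 1] qpow_add[of b 2 1] by (simp add: power3_eq_cube)

text \<open>Multiplying the sum by q gives q^2 + 1. This keeps the denominator of
  \<open>brace3 b\<close> away from zero.\<close>

lemma qpow_denominator:
  assumes "(qpow b 1)\<^sup>2 \<noteq> - 1"
  shows "qpow b 1 + qpow b (- 1) \<noteq> 0"
proof
  assume "qpow b 1 + qpow b (- 1) = 0"
  then have "qpow b 1 * (qpow b 1 + inverse (qpow b 1)) = 0" by (simp add: qpow_minus)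
  then have "(qpow b 1)\<^sup>2 + 1 = 0" by (simp add: distrib_left power2_eq_square)
  with assms show False by (simp add: eq_neg_iff_add_eq_0)
qed

lemma opp_opp [simp]: "opp (opp s) = s"
  by (cases s) auto

lemma sgn_val_opp [simp]: "sgn_val (opp s) = - sgn_val s"
  by (cases s) auto

text \<open>For the representation of sign \<open>s\<close>, one sign per node governs both which
  \<alpha> represents \<open>E i\<close> and the exponent of q representing
  \<open>K i\<close>.\<close>

fun node_sign :: "sign \<Rightarrow> node \<Rightarrow> sign" where
  "node_sign s N1 = s"
| "node_sign s N0 = opp s"

text \<open>The Cartan matrix has rank one. In this factored form it is the shift of the
  \<open>H\<close>-eigenvalue caused by \<open>E j\<close>, times the sign in the exponent of
  \<open>K i\<close>.\<close>

lemma cartan_node_sign: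
  "of_int (cartan i j) = 2 * sgn_val (node_sign s i) * sgn_val (node_sign s j)"
  by (cases i; cases j; cases s) (simp_all add: cartan_def)

lemma node_sign_opp: "i \<noteq> j \<Longrightarrow> node_sign s j = opp (node_sign s i)"
  by (cases i; cases j) simp_all

text \<open>Moving \<open>y\<close> to the right of \<open>x x x\<close> turns the left-hand side into
  \<open>(1 - a) (1 + a + a\<^sup>2 + \<beta> a) x x x y - (1 + a + a\<^sup>2 + \<beta> a) d x x\<close>.\<close>

lemma (in vector_space) serre_of_q_commutation:
  assumes x: "Vector_Spaces.linear scale scale x"
    and yx: "\<And>v. y (x v) = scale a (x (y v)) + scale d v"
    and \<beta>: "1 + a + a\<^sup>2 + \<beta> * a = 0"
  shows "x (x (x (y v))) + scale \<beta> (x (x (y (x v)))) - scale \<beta> (x (y (x (x v))))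
     - y (x (x (x v))) = 0"
proof -
  interpret x: Vector_Spaces.linear scale scale x by (rule x)
  let ?X = "x (x (x (y v)))" and ?Z = "x (x v)" and ?w = "1 + a + a\<^sup>2 + \<beta> * a"
  have 1: "x (x (y (x v))) = scale a ?X + scale d ?Z"
    by (simp add: yx x.add x.scale)
  have 2: "x (y (x (x v))) = scale (a * a) ?X + scale (a * d + d) ?Z"
    by (simp add: yx x.add x.scale scale_right_distrib scale_left_distrib add.assoc)
  have 3: "y (x (x (x v))) = scale (a * a * a) ?X + scale (a * a * d + a * d + d) ?Z"
    by (simp add: yx x.add x.scale scale_right_distrib scale_left_distrib add.assoc mult.assoc)
  have "?X + scale \<beta> (x (x (y (x v)))) - scale \<beta> (x (y (x (x v)))) - y (x (x (x v)))
      = (scale 1 ?X + scale (\<beta> * a) ?X - scale (\<beta> * (a * a)) ?X - scale (a * a * a) ?X)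
        + (scale (\<beta> * d) ?Z - scale (\<beta> * (a * d + d)) ?Z - scale (a * a * d + a * d + d) ?Z)"
    unfolding 1 2 3 by (simp add: scale_right_distrib)
  also have "\<dots> = scale (1 + \<beta> * a - \<beta> * (a * a) - a * a * a) ?X
        + scale (\<beta> * d - \<beta> * (a * d + d) - (a * a * d + a * d + d)) ?Z"
    by (simp only: scale_left_distrib scale_left_diff_distrib)
  also have "1 + \<beta> * a - \<beta> * (a * a) - a * a * a = (1 - a) * ?w"
    by (simp add: algebra_simps power2_eq_square)
  also have "\<beta> * d - \<beta> * (a * d + d) - (a * a * d + a * d + d) = - (d * ?w)"
    by (simp add: algebra_simps power2_eq_square)
  finally show ?thesis by (simp add: \<beta>)
qed

section \<open>Oscillator operators and powers of q on a Fock module with creation operator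
  \<open>A t\<close>\<close>

locale fock_operators =
  fixes b :: complex and t :: sign
    and scale :: "complex \<Rightarrow> 'v \<Rightarrow> 'v::ab_group_add"
    and V :: "bool \<Rightarrow> 'v set"
    and A :: "sign \<Rightarrow> 'v \<Rightarrow> 'v" and H :: "'v \<Rightarrow> 'v" and vac :: 'v
  assumes superspace: "superspace scale V"
    and linA: "\<And>s. Vector_Spaces.linear scale scale (A s)"
    and linH: "Vector_Spaces.linear scale scale H"
    and A_parity: "\<And>s r. A s ` V r \<subseteq> V (\<not> r)"
    and q_commutator: "\<And>v. scale (qpow b 1) (A Pos (A Neg v)) + scale (qpow b (- 1)) (A Neg (A Pos v))
           + scale (1 / (qpow b 1 + qpow b (- 1))) v = 0"
    and H_commutator: "\<And>s v. H (A s v) = A s (H v) + scale (2 * sgn_val s) (A s v)"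
    and vac: "vac \<in> V False" "H vac = 0"
    and inj_e: "inj (\<lambda>k. (A t ^^ k) vac)"
    and indep_e: "\<not> module.dependent scale (range (\<lambda>k. (A t ^^ k) vac))"
    and span_e: "module.span scale (range (\<lambda>k. (A t ^^ k) vac)) = UNIV"
begin

sublocale vector_space scale
  using superspace by (simp add: superspace_def)

sublocale vector_space_pair scale scale ..

sublocale A: Vector_Spaces.linear scale scale "A s" for s by (rule linA)
sublocale H: Vector_Spaces.linear scale scale H by (rule linH)

definition e :: "nat \<Rightarrow> 'v" where "e k = (A t ^^ k) vac"

lemma inj_basis: "inj e"
  and independent_basis: "independent (range e)"
  and span_basis: "span (range e) = UNIV"
  using inj_e indep_e span_e by (simp_all add: e_def[abs_def])

lemma linear_eq_on_basis:
  assumes "Vector_Spaces.linear scale scale f" "Vector_Spaces.linear scale scale g"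
    and "\<And>k. f (e k) = g (e k)"
  shows "f v = g v"
  using linear_eq_on[OF assms(1,2), of v "range e"] assms(3) span_basis by auto

lemma H_basis: "H (e k) = scale (2 * sgn_val t * of_nat k) (e k)"
  by (induction k) (simp_all add: e_def vac H_commutator A.scale algebra_simps)

lemma basis_parity: "e k \<in> V (odd k)"
proof (induction k)
  case (Suc k)
  then have "A t (e k) \<in> V (\<not> odd k)" using A_parity by blast
  then show ?case by (simp add: e_def)
qed (simp add: e_def vac)

text \<open>A finite spanning set would bound the size of the independent set
  \<open>range e\<close>, which is infinite because \<open>e\<close> is injective.\<close>

lemma infinite_dimensional: "infinite_dimensional scale"
  unfolding infinite_dimensional_def
  using independent_span_bound[OF _ independent_basis] finite_imageD[OF _ inj_basis] by force

lemma eigenvector_of_raised: "H v = scale \<mu> v \<Longrightarrow> H (A s v) = scale (\<mu> + 2 * sgn_val s) (A s v)"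
  by (simp add: H_commutator A.scale scale_left_distrib)

text \<open>A linear map may be prescribed on a basis; by injectivity of \<open>e\<close>,
  \<open>inv_into\<close> recovers the index of a basis vector.\<close>

lemma ex_qpow_operator:
  "\<exists>T. Vector_Spaces.linear scale scale T \<and>
     (\<forall>k. T (e k) = scale (qpow b (z * (2 * sgn_val t * of_nat k))) (e k))"
proof -
  obtain T where "Vector_Spaces.linear scale scale T"
    "\<forall>x\<in>range e. T x = scale (qpow b (z * (2 * sgn_val t * of_nat (inv_into UNIV e x)))) x"
    using linear_independent_extend[OF independent_basis,
        of "\<lambda>x. scale (qpow b (z * (2 * sgn_val t * of_nat (inv_into UNIV e x)))) x"] by blast
  then show ?thesis using inv_f_f[OF inj_basis] by (intro exI[of _ T]) simp
qed

definition qH :: "complex \<Rightarrow> 'v \<Rightarrow> 'v" where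
  "qH z = (SOME T. Vector_Spaces.linear scale scale T \<and>
     (\<forall>k. T (e k) = scale (qpow b (z * (2 * sgn_val t * of_nat k))) (e k)))"

lemma linear_qH: "Vector_Spaces.linear scale scale (qH z)"
  and qH_basis: "qH z (e k) = scale (qpow b (z * (2 * sgn_val t * of_nat k))) (e k)"
  using someI_ex[OF ex_qpow_operator[of z]] by (simp_all add: qH_def)

sublocale qH: Vector_Spaces.linear scale scale "qH z" for z by (rule linear_qH)

text \<open>\<open>qH\<close> is defined on the basis only, whereas \<open>is_qpow_op\<close> speaks
  of all eigenvectors. In the basis expansion of an eigenvector, only basis vectors of the same
  eigenvalue have nonzero coefficients, and \<open>qH z\<close> scales all of these equally.\<close>

lemma qH_eigenvector:
  assumes "H v = scale \<mu> v"
  shows "qH z v = scale (qpow b (z * \<mu>)) v"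
proof -
  have "v \<in> span (range e)" by (simp add: span_basis)
  then obtain S r where S: "finite S" "S \<subseteq> range e" and v: "v = (\<Sum>x\<in>S. scale (r x) x)"
    unfolding span_explicit by auto
  define m where "m x = 2 * sgn_val t * of_nat (inv_into UNIV e x)" for x
  have H: "H x = scale (m x) x" and T: "qH z x = scale (qpow b (z * m x)) x" if "x \<in> S" for x
    using that S inv_f_f[OF inj_basis] by (auto simp: m_def H_basis qH_basis)
  have "(\<Sum>x\<in>S. scale (r x * (m x - \<mu>)) x) = H v - scale \<mu> v"
    unfolding v by (simp add: H.sum H.scale H scale_sum_right sum_subtractf[symmetric] algebra_simps)
  also have "\<dots> = 0" using assms by simp
  finally have r0: "r x * (m x - \<mu>) = 0" if "x \<in> S" for x
    using independentD[OF independent_basis S, of "\<lambda>x. r x * (m x - \<mu>)"] that by blast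
  have "qH z v = (\<Sum>x\<in>S. scale (r x) (scale (qpow b (z * m x)) x))"
    unfolding v by (simp add: qH.sum qH.scale T)
  also have "\<dots> = (\<Sum>x\<in>S. scale (r x) (scale (qpow b (z * \<mu>)) x))"
    by (rule sum.cong) (use r0 in force)+
  also have "\<dots> = scale (qpow b (z * \<mu>)) v"
    by (simp add: v scale_sum_right mult.commute)
  finally show ?thesis .
qed

lemma is_qpow_op_qH: "is_qpow_op b z scale H (qH z)"
proof -
  have "range e \<subseteq> {v. \<exists>\<mu>. H v = scale \<mu> v}" using H_basis by blast
  then have "span {v. \<exists>\<mu>. H v = scale \<mu> v} = UNIV"
    using span_mono[of "range e"] span_basis by blast
  then show ?thesis by (simp add: is_qpow_op_def linear_qH qH_eigenvector)
qed

lemma qH_commute: "qH z (qH z' v) = qH z' (qH z v)"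
  using linear_eq_on_basis[OF Vector_Spaces.linear_compose[OF linear_qH[of z'] linear_qH[of z]]
      Vector_Spaces.linear_compose[OF linear_qH[of z] linear_qH[of z']], of v]
  by (simp add: qH_basis qH.scale mult.commute)

lemma qH_inverse: "qH z (qH (- z) v) = v"
  using linear_eq_on_basis[OF Vector_Spaces.linear_compose[OF linear_qH[of "- z"] linear_qH[of z]]
      linear_id, of v]
  by (simp add: qH_basis qH.scale flip: qpow_add)

text \<open>On the basis, \<open>A s (e k)\<close> satisfies the eigenvector equation with
  eigenvalue shifted by \<open>2 * sgn_val s\<close>. This argument treats raising and lowering
  operators alike, with no formula for the lowered vector.\<close>

lemma qH_A: "qH z (A s v) = scale (qpow b (2 * z * sgn_val s)) (A s (qH z v))"
proof -
  have "Vector_Spaces.linear scale scale (\<lambda>v. qH z (A s v))"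
    using Vector_Spaces.linear_compose[OF linA linear_qH] by (simp add: comp_def)
  moreover have "Vector_Spaces.linear scale scale (\<lambda>v. scale (qpow b (2 * z * sgn_val s)) (A s (qH z v)))"
    using linear_compose_scale_right Vector_Spaces.linear_compose[OF linear_qH linA] by (simp add: comp_def)
  moreover have "qH z (A s (e k)) = scale (qpow b (2 * z * sgn_val s)) (A s (qH z (e k)))" for k
    using qH_eigenvector[OF eigenvector_of_raised[OF H_basis[of k]], of z s]
    by (simp add: qH_basis A.scale algebra_simps flip: qpow_add)
  ultimately show ?thesis by (rule linear_eq_on_basis)
qed

text \<open>\<open>V r\<close> is spanned by the basis vectors of parity \<open>r\<close>, because \<open>V False\<close> and \<open>V True\<close> are
  independent and the basis is homogeneous.\<close>

lemma qH_parity: "qH z ` V r \<subseteq> V r"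
proof (rule image_subsetI)
  fix v assume v: "v \<in> V r"
  have sub: "subspace (V p)" and disj: "V False \<inter> V True = {0}" for p
    using superspace by (auto simp: superspace_def)
  define S where "S p = e ` {k. odd k = p}" for p
  have SV: "span (S p) \<subseteq> V p" for p
    using basis_parity by (intro span_minimal sub) (auto simp: S_def)
  have "range e = S r \<union> S (\<not> r)" by (auto simp: S_def)
  then have "v \<in> {x + y |x y. x \<in> span (S r) \<and> y \<in> span (S (\<not> r))}"
    using span_basis span_Un[of "S r" "S (\<not> r)"] by simp
  then obtain x y where xy: "v = x + y" "x \<in> span (S r)" "y \<in> span (S (\<not> r))"
    by blast
  have "y = v - x" using xy by simp
  then have "y \<in> V r \<inter> V (\<not> r)"
    using SV xy v subspace_diff[OF sub] by blast
  then have "y = 0" using disj by (cases r) auto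
  then have "v \<in> span (S r)" using xy by simp
  then have "qH z v \<in> span (qH z ` S r)" using qH.span_image by blast
  also have "\<dots> \<subseteq> span (S r)"
  proof (intro span_minimal subspace_span image_subsetI)
    show "qH z x \<in> span (S r)" if "x \<in> S r" for x
      using that span_scale[OF span_base[OF that]] by (auto simp: S_def qH_basis)
  qed
  finally show "qH z v \<in> V r" using SV by blast
qed

text \<open>Solving the q-commutation relation for the product with \<open>A s\<close> on the right
  gives the form required by \<open>serre_of_q_commutation\<close>, with
  \<open>a = - q\<^sup>2\<close> and \<open>d = - (q * c)\<close>.\<close>

lemma serre:
  assumes "(qpow b 1)\<^sup>2 \<noteq> - 1"
  shows "A s (A s (A s (A (opp s) v))) + scale (brace3 b) (A s (A s (A (opp s) (A s v))))
     - scale (brace3 b) (A s (A (opp s) (A s (A s v)))) - A (opp s) (A s (A s (A s v))) = 0"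
proof -
  \<comment> \<open>The sign is absorbed into \<open>q\<close>: exchanging the two oscillators
    replaces q by its inverse, which leaves \<open>c\<close> and \<open>brace3 b\<close>
    unchanged.\<close>
  define q c where "q = qpow b (sgn_val s)" and "c = 1 / (qpow b 1 + qpow b (- 1))"
  have q0: "q \<noteq> 0" by (simp add: q_def)
  have den: "q + inverse q \<noteq> 0"
    using qpow_denominator[OF assms] by (cases s) (auto simp: q_def qpow_minus add.commute)
  have "brace3 b = (q ^ 3 + inverse q ^ 3) / (q + inverse q)"
    by (cases s) (simp_all add: brace3_def q_def qpow_minus qpow_3 power_inverse add.commute)
  \<comment> \<open>Factorization of a sum of two cubes, where the product of the two bases is
    1.\<close>
  also have "q ^ 3 + inverse q ^ 3 = (q\<^sup>2 - 1 + inverse q ^ 2) * (q + inverse q)"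
    using q0 by (simp add: field_simps power2_eq_square power3_eq_cube)
  finally have br: "brace3 b = q\<^sup>2 - 1 + inverse q ^ 2" using den by simp
  have comm: "scale q (A s (A (opp s) v)) + scale (inverse q) (A (opp s) (A s v)) + scale c v = 0" for v
    using q_commutator[of v] by (cases s) (auto simp: q_def c_def qpow_minus algebra_simps)
  have yx: "A (opp s) (A s v) = scale (- q\<^sup>2) (A s (A (opp s) v)) + scale (- (q * c)) v" for v
  proof -
    have "scale q (scale q (A s (A (opp s) v)) + scale (inverse q) (A (opp s) (A s v)) + scale c v) = 0"
      by (simp only: comm scale_zero_right)
    then have "scale (q\<^sup>2) (A s (A (opp s) v)) + A (opp s) (A s v) + scale (q * c) v = 0"
      using q0 by (simp add: scale_right_distrib power2_eq_square)
    then have "(scale (q\<^sup>2) (A s (A (opp s) v)) + scale (q * c) v) + A (opp s) (A s v) = 0"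
      by (simp add: add_ac)
    from minus_unique[OF this] show ?thesis by simp
  qed
  \<comment> \<open>The remaining condition is 1 - q^2 + q^4 = q^2 (q^2 - 1 + q^(-2)).\<close>
  show ?thesis
    by (rule serre_of_q_commutation[OF linA yx])
       (use q0 in \<open>simp add: br field_simps power2_eq_square\<close>)
qed

section \<open>The action of the upper Borel generators\<close>

fun borel_op :: "complex \<Rightarrow> sign \<Rightarrow> borel_gens \<Rightarrow> 'v \<Rightarrow> 'v" where
  "borel_op lam s (E i) = (\<lambda>v. scale lam (A (node_sign s i) v))"
| "borel_op lam s (K i) = qH (sgn_val (node_sign s i))"
| "borel_op lam s (Kinv i) = qH (- sgn_val (node_sign s i))"

lemma operator_family_borel: "operator_family scale V borel_parity (borel_op lam s)"
proof (rule operator_family.intro)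
  show "superspace scale V" by (rule superspace)
  show "Vector_Spaces.linear scale scale (borel_op lam s g)" for g
    by (cases g) (simp_all add: linear_qH linear_compose_scale_right linA)
  have "subspace (V r)" for r
    using superspace by (auto simp: superspace_def)
  then have "(\<lambda>v. scale lam (A s v)) ` V r \<subseteq> V (\<not> r)" for lam s r
    using A_parity[of s r] by (blast intro: subspace_scale)
  then show "borel_op lam s g ` V r \<subseteq> V (r \<noteq> borel_parity g)" for g r
    using qH_parity by (cases g) simp_all
qed

lemma borel_representation:
  assumes "(qpow b 1)\<^sup>2 \<noteq> - 1"
  shows "\<exists>\<rho>. superrep (borel b) scale V \<rho> \<and> (\<forall>g. \<rho> (borel_gen b g) = borel_op lam s g)"
proof -
  interpret operator_family scale V borel_parity "borel_op lam s"
    by (rule operator_family_borel)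
  have inv: "qH (- z) (qH z v) = v" for z v
    using qH_inverse[of "- z"] by simp
  have "free_eval r v = 0" if "r \<in> borel_rels b" for r v
  proof -
    from that show ?thesis
      unfolding borel_rels_def
    proof (elim UnE CollectE exE conjE)
      fix i assume "r = gen (K i) * gen (Kinv i) - 1"
      then show ?thesis by (simp add: qH_inverse inv)
    next
      fix i assume "r = gen (Kinv i) * gen (K i) - 1"
      then show ?thesis by (simp add: qH_inverse inv)
    next
      fix i j assume "r = gen (K i) * gen (K j) - gen (K j) * gen (K i)"
      then show ?thesis by (simp add: qH_commute)
    next
      fix i j
      assume "r = gen (K i) * gen (E j) - scal (qpow b (of_int (cartan i j))) * gen (E j) * gen (K i)"
      then show ?thesis
        by (simp add: cartan_node_sign[of i j s] qH_A qH.scale mult.commute)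
    next
      fix i j :: node
      assume ij: "i \<noteq> j" and r: "r = gen (E i) ^ 3 * gen (E j)
        + scal (brace3 b) * gen (E i) ^ 2 * gen (E j) * gen (E i)
        - scal (brace3 b) * gen (E i) * gen (E j) * gen (E i) ^ 2
        - gen (E j) * gen (E i) ^ 3"
      define s' where "s' = node_sign s i"
      have s': "borel_op lam s (E i) = (\<lambda>v. scale lam (A s' v))"
        "borel_op lam s (E j) = (\<lambda>v. scale lam (A (opp s') v))"
        using node_sign_opp[OF ij] by (simp_all add: s'_def)
      \<comment> \<open>Every term of the Serre relation has degree four in the odd generators, so
        the parameter factors out.\<close>
      have "free_eval r v = scale (lam ^ 4) (A s' (A s' (A s' (A (opp s') v)))
           + scale (brace3 b) (A s' (A s' (A (opp s') (A s' v))))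
           - scale (brace3 b) (A s' (A (opp s') (A s' (A s' v)))) - A (opp s') (A s' (A s' (A s' v))))"
        by (simp add: r s' A.scale del: borel_op.simps add: power2_eq_square power3_eq_cube power4_eq_xxxx
            scale_right_distrib scale_right_diff_distrib ac_simps)
      then show ?thesis using serre[OF assms] by simp
    qed
  qed
  then show ?thesis
    unfolding borel_def borel_gen_def by (rule presented_lift)
qed

end

text \<open>The defining relations of \<open>osc b\<close> act as zero; evaluating them letter by
  letter yields the operator identities.\<close>

lemma fock_module_operators:
  assumes "fock_module b t scale V \<pi> vac"
  shows "fock_operators b t scale V (\<lambda>s. \<pi> (osc_gen b (Alpha s))) (\<pi> (osc_gen b Ham)) vac"
proof -
  have rep: "superrep (presented osc_parity (osc_rels b)) scale V \<pi>"
    using assms by (simp add: fock_module_def osc_def)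
  interpret operator_family scale V osc_parity "\<lambda>g. \<pi> (osc_gen b g)"
    unfolding osc_gen_def by (rule presented_operator_family[OF rep])
  have rel: "free_eval r v = 0" if "r \<in> osc_rels b" for r v
    using presented_relation[OF rep that] unfolding osc_gen_def by simp
  have q_commutator: "scal (qpow b 1) * gen (Alpha Pos) * gen (Alpha Neg)
        + scal (qpow b (- 1)) * gen (Alpha Neg) * gen (Alpha Pos)
        + scal (1 / (qpow b 1 + qpow b (- 1))) \<in> osc_rels b"
    and H_commutator: "gen Ham * gen (Alpha s) - gen (Alpha s) * gen Ham
          - scal (2 * sgn_val s) * gen (Alpha s) \<in> osc_rels b" for s
    unfolding osc_rels_def by blast+
  show ?thesis
  proof (rule fock_operators.intro)
    show "\<pi> (osc_gen b (Alpha s)) ` V r \<subseteq> V (\<not> r)" for s r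
      using parity[of "Alpha s" r] by (simp add: osc_parity_def)
    show "scale (qpow b 1) (\<pi> (osc_gen b (Alpha Pos)) (\<pi> (osc_gen b (Alpha Neg)) v))
        + scale (qpow b (- 1)) (\<pi> (osc_gen b (Alpha Neg)) (\<pi> (osc_gen b (Alpha Pos)) v))
        + scale (1 / (qpow b 1 + qpow b (- 1))) v = 0" for v
      using rel[OF q_commutator, of v] by simp
    show "\<pi> (osc_gen b Ham) (\<pi> (osc_gen b (Alpha s)) v) = \<pi> (osc_gen b (Alpha s)) (\<pi> (osc_gen b Ham) v)
        + scale (2 * sgn_val s) (\<pi> (osc_gen b (Alpha s)) v)" for s v
      using rel[OF H_commutator, of s v] by (simp add: diff_diff_eq)
  qed (use assms lin superspace in \<open>simp_all add: fock_module_def Let_def\<close>)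
qed


section \<open>The polynomial Fock module\<close>

lemma vector_space_poly: "vector_space (Polynomial.smult :: 'a::field \<Rightarrow> 'a poly \<Rightarrow> 'a poly)"
  by unfold_locales (simp_all add: smult_add_right smult_add_left)

interpretation poly_space: vector_space "Polynomial.smult :: 'a::field \<Rightarrow> 'a poly \<Rightarrow> 'a poly"
  by (rule vector_space_poly)

text \<open>The span of the other monomials lies in the subspace where the \<open>k\<close>-th
  coefficient vanishes.\<close>

lemma independent_monom: "poly_space.independent (range (\<lambda>k. monom (1::'a::field) k))"
proof
  assume "poly_space.dependent (range (\<lambda>k. monom (1::'a) k))"
  then obtain k where "monom (1::'a) k \<in> poly_space.span (range (\<lambda>k. monom 1 k) - {monom 1 k})"
    unfolding poly_space.dependent_def by blast
  also have "\<dots> \<subseteq> {p. coeff p k = 0}"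
    by (rule poly_space.span_minimal) (auto simp: poly_space.subspace_def)
  finally show False by simp
qed

lemma span_monom: "poly_space.span (range (\<lambda>k. monom (1::'a::field) k)) = UNIV"
proof -
  have "p \<in> poly_space.span (range (\<lambda>k. monom 1 k))" for p :: "'a poly"
  proof -
    have "(\<Sum>i\<le>degree p. Polynomial.smult (coeff p i) (monom 1 i)) \<in> poly_space.span (range (\<lambda>k. monom 1 k))"
      by (intro poly_space.span_sum poly_space.span_scale poly_space.span_base) auto
    then show ?thesis by (simp add: smult_monom poly_as_sum_of_monoms)
  qed
  then show ?thesis by auto
qed

definition poly_part :: "bool \<Rightarrow> 'a::zero poly set" where
  "poly_part r = {p. \<forall>n. coeff p n \<noteq> 0 \<longrightarrow> odd n = r}"

lemma superspace_poly: "superspace (Polynomial.smult :: complex \<Rightarrow> complex poly \<Rightarrow> complex poly) poly_part"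
  unfolding superspace_def
proof (intro conjI allI)
  show "vector_space (Polynomial.smult :: complex \<Rightarrow> _)" by (rule vector_space_poly)
  show "poly_space.subspace (poly_part r :: complex poly set)" for r
    by (auto simp: poly_space.subspace_def poly_part_def) (metis add_0)+
  show "poly_part False \<inter> poly_part True = ({0} :: complex poly set)"
    by (auto simp: poly_part_def poly_eq_iff)
  fix p :: "complex poly"
  \<comment> \<open>The even part of \<open>p\<close>; \<open>Abs_poly\<close> is legitimate because
    the coefficients vanish beyond the degree of \<open>p\<close>.\<close>
  define x where "x = Abs_poly (\<lambda>n. if even n then coeff p n else 0)"
  have "coeff x = (\<lambda>n. if even n then coeff p n else 0)"
    unfolding x_def by (rule coeff_Abs_poly[of "degree p"]) (simp add: coeff_eq_0)
  then have "x \<in> poly_part False" "p - x \<in> poly_part True"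
    by (auto simp: poly_part_def split: if_splits)
  then show "\<exists>x\<in>poly_part False. \<exists>y\<in>poly_part True. p = x + y"
    by (intro bexI[of _ x] bexI[of _ "p - x"]) auto
qed

text \<open>The annihilation operator sends the \<open>k\<close>-th basis vector to \<open>lower_coeff b t k\<close> times the
  previous one; the q-commutation relation forces this recursion.\<close>

fun lower_coeff :: "complex \<Rightarrow> sign \<Rightarrow> nat \<Rightarrow> complex" where
  "lower_coeff b t 0 = 0"
| "lower_coeff b t (Suc k) = - qpow b (sgn_val t) *
     (qpow b (sgn_val t) * lower_coeff b t k + 1 / (qpow b 1 + qpow b (- 1)))"

text \<open>This is the q-commutation relation on the \<open>k\<close>-th basis vector: lowering
  then raising gives \<open>lower_coeff b t k\<close>, raising then lowering gives
  \<open>lower_coeff b t (Suc k)\<close>.\<close>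

lemma lower_coeff_recurrence:
  "qpow b (sgn_val t) * lower_coeff b t k + inverse (qpow b (sgn_val t)) * lower_coeff b t (Suc k)
     + 1 / (qpow b 1 + qpow b (- 1)) = 0"
proof -
  have "inverse q * (- q * x) = - x" if "q \<noteq> 0" for q x :: complex
    using that by simp
  then show ?thesis by (simp del: mult_minus_left)
qed

definition lower :: "complex \<Rightarrow> sign \<Rightarrow> complex poly \<Rightarrow> complex poly" where
  "lower b t p = Abs_poly (\<lambda>n. lower_coeff b t (Suc n) * coeff p (Suc n))"

lemma coeff_lower [simp]: "coeff (lower b t p) n = lower_coeff b t (Suc n) * coeff p (Suc n)"
  unfolding lower_def by (subst coeff_Abs_poly[of "degree p"]) (simp_all add: coeff_eq_0)

text \<open>The model has the monomials as Fock basis: creation is multiplication by the variable,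
  and \<open>Ham\<close> is a multiple of the Euler operator, which reads off the degree.\<close>

definition fock_op :: "complex \<Rightarrow> sign \<Rightarrow> osc_gens \<Rightarrow> complex poly \<Rightarrow> complex poly" where
  "fock_op b t g = (case g of
     Ham \<Rightarrow> (\<lambda>p. Polynomial.smult (2 * sgn_val t) (pCons 0 (pderiv p)))
   | Alpha s \<Rightarrow> if s = t then pCons 0 else lower b t)"

lemma operator_family_fock: "operator_family Polynomial.smult poly_part osc_parity (fock_op b t)"
proof (rule operator_family.intro)
  show "superspace (Polynomial.smult :: complex \<Rightarrow> _) poly_part" by (rule superspace_poly)
  show "Vector_Spaces.linear Polynomial.smult Polynomial.smult (fock_op b t g)" for g
    unfolding Vector_Spaces.linear_iff
    by (auto simp: vector_space_poly fock_op_def poly_eq_iff coeff_pCons coeff_pderiv algebra_simps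
        split: osc_gens.splits nat.splits simp del: lower_coeff.simps)
  show "fock_op b t g ` poly_part r \<subseteq> poly_part (r \<noteq> osc_parity g)" for g r
    by (auto simp: poly_part_def fock_op_def osc_parity_def coeff_pCons coeff_pderiv
        split: osc_gens.splits nat.splits if_splits simp del: lower_coeff.simps)
qed

text \<open>Both oscillator relations are checked coefficientwise for \<open>fock_op\<close>; the
  universal property then supplies the representation, with the constant polynomial \<open>1\<close>
  as vacuum.\<close>

lemma ex_fock_module:
  "\<exists>\<pi> vac. fock_module b t Polynomial.smult poly_part \<pi> vac"
proof -
  interpret operator_family Polynomial.smult poly_part osc_parity "fock_op b t"
    by (rule operator_family_fock)
  have "free_eval r p = 0" if r: "r \<in> osc_rels b" for r p
  proof (rule poly_eqI)
    fix n
    consider "r = scal (qpow b 1) * gen (Alpha Pos) * gen (Alpha Neg)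
        + scal (qpow b (- 1)) * gen (Alpha Neg) * gen (Alpha Pos)
        + scal (1 / (qpow b 1 + qpow b (- 1)))"
      | s where "r = gen Ham * gen (Alpha s) - gen (Alpha s) * gen Ham
          - scal (2 * sgn_val s) * gen (Alpha s)"
      using r unfolding osc_rels_def by blast
    then show "coeff (free_eval r p) n = coeff 0 n"
    proof cases
      case 1
      then have "coeff (free_eval r p) n
          = qpow b 1 * coeff (fock_op b t (Alpha Pos) (fock_op b t (Alpha Neg) p)) n
            + qpow b (- 1) * coeff (fock_op b t (Alpha Neg) (fock_op b t (Alpha Pos) p)) n
            + 1 / (qpow b 1 + qpow b (- 1)) * coeff p n"
        by simp
      \<comment> \<open>For \<open>n = 0\<close>, lowering followed by raising contributes nothing,
        in agreement with \<open>lower_coeff b t 0 = 0\<close>.\<close>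
      also have "\<dots> = (qpow b (sgn_val t) * lower_coeff b t n
            + inverse (qpow b (sgn_val t)) * lower_coeff b t (Suc n)
            + 1 / (qpow b 1 + qpow b (- 1))) * coeff p n"
        by (cases t; cases n)
           (simp_all add: fock_op_def qpow_minus coeff_pCons ring_distribs mult.assoc
             del: lower_coeff.simps(2))
      finally show ?thesis by (simp only: lower_coeff_recurrence mult_zero_left coeff_0)
    next
      case 2
      then have "coeff (free_eval r p) n
          = coeff (fock_op b t Ham (fock_op b t (Alpha s) p)) n
            - coeff (fock_op b t (Alpha s) (fock_op b t Ham p)) n
            - 2 * sgn_val s * coeff (fock_op b t (Alpha s) p) n"
        by simp
      then show ?thesis
        by (cases t; cases s; cases n)
           (auto simp: fock_op_def coeff_pCons coeff_pderiv algebra_simps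
             split: nat.splits simp del: lower_coeff.simps)
    qed
  qed
  then obtain \<pi> where \<pi>: "superrep (osc b) Polynomial.smult poly_part \<pi>"
    "\<And>g. \<pi> (osc_gen b g) = fock_op b t g"
    using presented_lift[of "osc_rels b"] unfolding osc_def osc_gen_def by blast
  have "(fock_op b t (Alpha t) ^^ k) 1 = monom 1 k" for k
    by (induction k) (simp_all add: fock_op_def monom_Suc one_pCons monom_0)
  moreover have "fock_op b t (Alpha (opp t)) 1 = 0" "fock_op b t Ham 1 = 0"
    by (cases t; auto simp: fock_op_def poly_eq_iff)+
  moreover have "(1 :: complex poly) \<in> poly_part False"
    by (auto simp: poly_part_def)
  moreover have "inj (monom (1::complex))"
    by (auto simp: inj_def monom_eq_iff')
  ultimately have "fock_module b t Polynomial.smult poly_part \<pi> 1"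
    unfolding fock_module_def using \<pi> independent_monom span_monom by (simp add: Let_def)
  then show ?thesis by blast
qed

text \<open>The sign \<open>s\<close> of the representation and the sign \<open>t\<close> of the
  Fock module vary independently. The first conjunct shows that the notion of Fock module is not
  vacuous for either sign.\<close>

theorem lemma3p3:
  fixes b lam :: complex
    and s t :: sign
    and scale :: "complex \<Rightarrow> 'v \<Rightarrow> 'v::ab_group_add"
    and V :: "bool \<Rightarrow> 'v set"
    and \<pi> :: "osc_gens free_alg set \<Rightarrow> 'v \<Rightarrow> 'v"
    and vac :: 'v
  assumes "(qpow b 1)\<^sup>2 \<noteq> - 1"
    and "lam \<noteq> 0"
  shows "(\<exists>V0 \<pi>0 vac0. fock_module b t (Polynomial.smult :: complex \<Rightarrow> complex poly \<Rightarrow> complex poly)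
            V0 \<pi>0 vac0) \<and>
    (fock_module b t scale V \<pi> vac \<longrightarrow>
      infinite_dimensional scale \<and>
      (\<exists>\<rho>. superrep (borel b) scale V \<rho> \<and>
         \<rho> (borel_gen b (E N1)) = (\<lambda>v. scale lam (\<pi> (osc_gen b (Alpha s)) v)) \<and>
         \<rho> (borel_gen b (E N0)) = (\<lambda>v. scale lam (\<pi> (osc_gen b (Alpha (opp s))) v)) \<and>
         is_qpow_op b (sgn_val s) scale (\<pi> (osc_gen b Ham)) (\<rho> (borel_gen b (K N1))) \<and>
         is_qpow_op b (- sgn_val s) scale (\<pi> (osc_gen b Ham)) (\<rho> (borel_gen b (K N0)))))"
proof (intro conjI impI)
  show "\<exists>V0 \<pi>0 vac0. fock_module b t (Polynomial.smult :: complex \<Rightarrow> complex poly \<Rightarrow> complex poly) V0 \<pi>0 vac0"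
    using ex_fock_module by blast
next
  assume "fock_module b t scale V \<pi> vac"
  then interpret fock_operators b t scale V "\<lambda>s. \<pi> (osc_gen b (Alpha s))" "\<pi> (osc_gen b Ham)" vac
    by (rule fock_module_operators)
  show "infinite_dimensional scale" by (rule infinite_dimensional)
  obtain \<rho> where "superrep (borel b) scale V \<rho>" "\<And>g. \<rho> (borel_gen b g) = borel_op lam s g"
    using borel_representation[OF assms(1)] by blast
  then show "\<exists>\<rho>. superrep (borel b) scale V \<rho> \<and>
         \<rho> (borel_gen b (E N1)) = (\<lambda>v. scale lam (\<pi> (osc_gen b (Alpha s)) v)) \<and>
         \<rho> (borel_gen b (E N0)) = (\<lambda>v. scale lam (\<pi> (osc_gen b (Alpha (opp s))) v)) \<and>
         is_qpow_op b (sgn_val s) scale (\<pi> (osc_gen b Ham)) (\<rho> (borel_gen b (K N1))) \<and>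
         is_qpow_op b (- sgn_val s) scale (\<pi> (osc_gen b Ham)) (\<rho> (borel_gen b (K N0)))"
    by (intro exI[of _ \<rho>]) (simp add: is_qpow_op_qH)
qed

end
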